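(* Let $d$ be an odd positive integer, let $\chi$ be a Dirichlet character with conductor $d$, and let $w_1,w_2$ be odd natural numbers. Then for every integer $n\ge 0$, every integer $m\ge 1$, and all $x,y$, $$\sum_{k=0}^n \binom{n}{k}w_1^{k}w_2^{n-k}E_{n-k,\chi}^{(m-1)}(w_1y)\sum_{i=0}^{w_1d-1}\chi(i)(-1)^i E_{k,\chi}^{(m)}\left(w_2x+\frac{w_2}{w_1}i\right)$$ $$=\sum_{k=0}^n \binom{n}{k}w_2^{k}w_1^{n-k}E_{n-k,\chi}^{(m-1)}(w_2y)\sum_{i=0}^{w_2d-1}\chi(i)(-1)^iE_{k,\chi}^{(m)}\left(w_1x+\frac{w_1}{w_2}i\right).$$
   Context: $d$ is an odd positive integer and $\chi$ is a Dirichlet character with conductor $d$ (regarded as a complex-valued function on the integers, periodic mod $d$; for $d=1$, $\chi$ is identically $1$, including $\chi(0)=1$). For an integer $\alpha\ge 0$, the generalized higher-order Euler polynomials $E_{n,\chi}^{(\alpha)}(x)$ attached to $\chi$ are defined by $$\left(\frac{2\sum_{a=0}^{d-1}(-1)^a\chi(a)e^{at}}{e^{dt}+1}\right)^{\alpha}e^{xt}=\sum_{n=0}^{\infty}E_{n,\chi}^{(\alpha)}(x)\frac{t^n}{n!},\qquad |t|<\frac{\pi}{d}$$ (equivalently, as an identity of formal power series in $t$), where the $0$-th power is $1$, so that $E_{n,\chi}^{(0)}(x)=x^n$. The variables $x,y$ are indeterminates (or arbitrary complex numbers). *)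

theory Defs
  imports Complex_Main "HOL-Computational_Algebra.Formal_Power_Series"
begin

text \<open>For modulus 1 the last condition gives \<open>\<chi> 0 \<noteq> 0\<close>; together with periodicity and
  \<open>\<chi> 1 = 1\<close> this makes \<open>\<chi>\<close> constantly 1.\<close>

definition dirichlet_char :: "nat \<Rightarrow> (int \<Rightarrow> complex) \<Rightarrow> bool" where
  "dirichlet_char q \<chi> \<longleftrightarrow>
     q > 0 \<and>
     (\<forall>a. \<chi> (a + int q) = \<chi> a) \<and>
     (\<forall>a b. \<chi> (a * b) = \<chi> a * \<chi> b) \<and>
     \<chi> 1 = 1 \<and>
     (\<forall>a. \<chi> a = 0 \<longleftrightarrow> \<not> coprime a (int q))"

text \<open>The conductor of a character modulo \<open>q\<close>: the least divisor \<open>f\<close> of \<open>q\<close> such that the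
  character is induced by a character modulo \<open>f\<close>.\<close>

definition dirichlet_conductor :: "nat \<Rightarrow> (int \<Rightarrow> complex) \<Rightarrow> nat" where
  "dirichlet_conductor q \<chi> =
     (LEAST f. f dvd q \<and>
        (\<exists>\<psi>. dirichlet_char f \<psi> \<and> (\<forall>a. coprime a (int q) \<longrightarrow> \<chi> a = \<psi> a)))"

text \<open>The denominator has constant coefficient 2, so the quotient is the usual quotient by a unit of
  the ring of formal power series.\<close>

definition gen_euler_fps :: "nat \<Rightarrow> (int \<Rightarrow> complex) \<Rightarrow> nat \<Rightarrow> complex \<Rightarrow> complex fps" where
  "gen_euler_fps d \<chi> \<alpha> x =
     ((2 * (\<Sum>a<d. fps_const ((-1) ^ a * \<chi> (int a)) * fps_exp (of_nat a)))
       / (fps_exp (of_nat d) + 1)) ^ \<alpha> * fps_exp x"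

definition gen_euler_poly :: "nat \<Rightarrow> (int \<Rightarrow> complex) \<Rightarrow> nat \<Rightarrow> nat \<Rightarrow> complex \<Rightarrow> complex" where
  "gen_euler_poly d \<chi> \<alpha> n x = fact n * fps_nth (gen_euler_fps d \<chi> \<alpha> x) n"

lemma gen_euler_poly_egf:
  "Abs_fps (\<lambda>n. gen_euler_poly d \<chi> \<alpha> n x / fact n) = gen_euler_fps d \<chi> \<alpha> x"
  by (simp add: fps_eq_iff gen_euler_poly_def)

lemma gen_euler_poly_order_0: "gen_euler_poly d \<chi> 0 n x = x ^ n"
  by (simp add: gen_euler_poly_def gen_euler_fps_def)

lemma dirichlet_char_1: "dirichlet_char 1 \<chi> \<longleftrightarrow> \<chi> = (\<lambda>_. 1)"
proof
  assume "dirichlet_char 1 \<chi>"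
  then have "\<chi> (a + 1) = \<chi> a" and "\<chi> 1 = 1" for a
    by (simp_all add: dirichlet_char_def)
  then have "\<chi> a = 1" for a
    by (induction a rule: int_induct[where k = 1]) (simp_all, metis diff_add_cancel)
  then show "\<chi> = (\<lambda>_. 1)" by blast
qed (simp add: dirichlet_char_def)

end

theory Submission
  imports Defs
begin

text \<open>Writing \<open>G\<close> for the quotient defining the polynomials, the left-hand side is
  \<open>n!\<close> times the \<open>n\<close>-th coefficient of
  \<open>G(w\<^sub>1 t)\<^sup>m G(w\<^sub>2 t)\<^sup>m exp(w\<^sub>1 w\<^sub>2 (x + y) t) (exp(d w\<^sub>1 w\<^sub>2 t) + 1) / 2\<close>,
  which is symmetric in \<open>w\<^sub>1\<close> and \<open>w\<^sub>2\<close>: the inner character sum, a geometric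
  series in \<open>-exp(d w\<^sub>2 t)\<close>, supplies the missing \<open>m\<close>-th factor \<open>G(w\<^sub>2 t)\<close>.\<close>

unbundle fps_syntax

text \<open>The length \<open>N\<close> is left free: \<open>N = d\<close> gives half the numerator
  of the defining quotient, and \<open>N = w1 * d\<close> gives the range of the inner sum in the
  theorem.\<close>

definition char_exp_sum :: "(int \<Rightarrow> complex) \<Rightarrow> nat \<Rightarrow> complex fps" where
  "char_exp_sum \<chi> N = (\<Sum>a<N. fps_const ((-1) ^ a * \<chi> (int a)) * fps_exp (of_nat a))"

definition euler_quotient :: "nat \<Rightarrow> (int \<Rightarrow> complex) \<Rightarrow> complex fps" where
  "euler_quotient d \<chi> = 2 * char_exp_sum \<chi> d / (fps_exp (of_nat d) + 1)"

text \<open>The substitution of c t for t. The inner series has no constant term, so this is a ring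
  homomorphism, and it sends exp(a t) to exp(c a t).\<close>

abbreviation fps_scale :: "complex \<Rightarrow> complex fps \<Rightarrow> complex fps" where
  "fps_scale c f \<equiv> f oo (fps_const c * fps_X)"

lemma gen_euler_fps_eq: "gen_euler_fps d \<chi> \<alpha> x = euler_quotient d \<chi> ^ \<alpha> * fps_exp x"
  by (simp add: gen_euler_fps_def euler_quotient_def char_exp_sum_def)

lemma dirichlet_char_periodic_mult:
  assumes "dirichlet_char d \<chi>"
  shows "\<chi> (a + int (j * d)) = \<chi> a"
proof (induction j)
  case (Suc j)
  have "\<chi> (a + int (Suc j * d)) = \<chi> (a + int (j * d) + int d)"
    by (simp add: algebra_simps)
  also have "\<dots> = \<chi> (a + int (j * d))"
    using assms unfolding dirichlet_char_def by blast
  finally show ?case using Suc by simp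
qed simp

text \<open>Cut the range into \<open>N\<close> blocks of length \<open>d\<close>. By periodicity of
  \<open>\<chi>\<close> and oddness of \<open>d\<close>, block \<open>j\<close> is the first block
  times (-exp(d t))^j. The resulting geometric series has numerator 1 + exp(N d t) because
  \<open>N\<close> is odd. Cross-multiplying avoids division.\<close>

lemma char_exp_sum_mult:
  assumes "dirichlet_char d \<chi>" and "odd d" and "odd N"
  shows "char_exp_sum \<chi> (N * d) * (fps_exp (of_nat d) + 1)
       = char_exp_sum \<chi> d * (fps_exp (of_nat (N * d)) + 1)"
proof -
  let ?f = "\<lambda>a. fps_const ((-1) ^ a * \<chi> (int a)) * fps_exp (of_nat a) :: complex fps"
  let ?q = "- fps_exp (of_nat d) :: complex fps"
  have shift: "?f (a + j * d) = ?f a * ?q ^ j" for a j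
  proof -
    have q: "?q ^ j = (-1) ^ j * fps_exp (of_nat (j * d))"
      by (subst power_minus) (simp add: fps_exp_power_mult)
    have sgn: "((-1) ^ (a + j * d) :: complex) = (-1) ^ a * (-1) ^ j"
      using assms(2) by (simp add: power_add power_mult mult.commute[of j])
    have one: "((-1) ^ j :: complex fps) = fps_const ((-1) ^ j)"
      by (simp flip: fps_const_power fps_const_neg)
    have "\<chi> (int (a + j * d)) = \<chi> (int a)"
      using dirichlet_char_periodic_mult[OF assms(1), of "int a" j] by simp
    then show ?thesis
      unfolding q one sgn of_nat_add fps_exp_add_mult
      by (simp add: mult_ac flip: fps_const_mult)
  qed
  have "char_exp_sum \<chi> (N * d) = (\<Sum>j<N. \<Sum>a\<in>{j*d..<j*d+d}. ?f a)"
    unfolding char_exp_sum_def by (rule sum.nat_group[symmetric])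
  also have "\<dots> = (\<Sum>j<N. \<Sum>a<d. ?f (a + j * d))"
  proof (rule sum.cong[OF refl])
    fix j
    show "(\<Sum>a\<in>{j*d..<j*d+d}. ?f a) = (\<Sum>a<d. ?f (a + j * d))"
      using sum.shift_bounds_nat_ivl[of ?f 0 "j * d" d]
      by (simp only: add_0 atLeast0LessThan add.commute[of d])
  qed
  also have "\<dots> = char_exp_sum \<chi> d * (\<Sum>j<N. ?q ^ j)"
    unfolding shift char_exp_sum_def sum_distrib_left sum_distrib_right ..
  finally have "char_exp_sum \<chi> (N * d) * (fps_exp (of_nat d) + 1)
      = char_exp_sum \<chi> d * ((1 - ?q) * (\<Sum>j<N. ?q ^ j))"
    by (simp add: mult_ac add.commute)
  also have "(1 - ?q) * (\<Sum>j<N. ?q ^ j) = 1 - ?q ^ N"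
    by (rule one_diff_power_eq[symmetric])
  also have "\<dots> = fps_exp (of_nat (N * d)) + 1"
    using assms(3) by (simp add: fps_exp_power_mult)
  finally show ?thesis .
qed

text \<open>Replacing \<open>d\<close> by an odd multiple \<open>N * d\<close> in numerator and
  denominator leaves the Euler quotient unchanged.\<close>

lemma char_exp_sum_eq_euler_quotient:
  assumes "dirichlet_char d \<chi>" and "odd d" and "odd N"
  shows "2 * char_exp_sum \<chi> (N * d) = euler_quotient d \<chi> * (fps_exp (of_nat (N * d)) + 1)"
proof -
  let ?D = "fps_exp (of_nat d) + 1 :: complex fps"
  \<comment> \<open>The constant coefficient is 2, so \<open>?D\<close> is a unit: division by it is
    genuine, and it can be cancelled at the end.\<close>
  have D0: "?D $ 0 \<noteq> 0"
    by simp
  then have D: "?D \<noteq> 0"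
    by force
  have "euler_quotient d \<chi> * ?D = 2 * char_exp_sum \<chi> d"
    unfolding euler_quotient_def fps_divide_unit[OF D0]
    using inverse_mult_eq_1[OF D0] by (simp add: mult.assoc)
  then have "2 * char_exp_sum \<chi> (N * d) * ?D = euler_quotient d \<chi> * ?D * (fps_exp (of_nat (N * d)) + 1)"
    using char_exp_sum_mult[OF assms] by (simp only: mult.assoc)
  also have "\<dots> = euler_quotient d \<chi> * (fps_exp (of_nat (N * d)) + 1) * ?D"
    by (simp only: mult_ac)
  finally show ?thesis
    unfolding mult_right_cancel[OF D] .
qed

lemma fps_scale_gen_euler_fps:
  "fps_scale c (gen_euler_fps d \<chi> \<alpha> x) = fps_scale c (euler_quotient d \<chi>) ^ \<alpha> * fps_exp (c * x)"
  by (simp add: gen_euler_fps_eq fps_compose_mult_distrib fps_compose_power fps_exp_compose_linear)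

text \<open>Scaling t by \<open>c\<close> multiplies the \<open>n\<close>-th coefficient by
  \<open>c ^ n\<close>; this absorbs the powers of \<open>w1\<close> and \<open>w2\<close> in the
  theorem.\<close>

lemma power_mult_gen_euler_poly:
  "c ^ n * gen_euler_poly d \<chi> \<alpha> n x
     = fact n * (fps_scale c (euler_quotient d \<chi>) ^ \<alpha> * fps_exp (c * x)) $ n"
  unfolding fps_scale_gen_euler_fps[symmetric] by (simp add: gen_euler_poly_def)

text \<open>Binomial convolution is the product of exponential generating functions.\<close>

lemma binomial_sum_fps_nth:
  fixes f g :: "complex fps"
  shows "(\<Sum>k=0..n. of_nat (n choose k) * (fact k * f $ k) * (fact (n - k) * g $ (n - k)))
       = fact n * (f * g) $ n"
proof -
  have "of_nat (n choose k) * (fact k * f $ k) * (fact (n - k) * g $ (n - k))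
      = fact n * (f $ k * g $ (n - k))" if "k \<in> {0..n}" for k
    using that by (simp add: binomial_fact)
  then show ?thesis
    by (simp only: fps_mult_nth sum_distrib_left cong: sum.cong)
qed

lemma sum_gen_euler_poly_eq_fps_nth:
  fixes w1 w2 :: nat
  assumes "dirichlet_char d \<chi>" and "odd d" and "odd w1" and "m \<ge> 1"
  defines "G \<equiv> \<lambda>c. fps_scale (of_nat c) (euler_quotient d \<chi>)"
  shows "(\<Sum>k=0..n. of_nat (n choose k) * of_nat w1 ^ k * of_nat w2 ^ (n - k)
        * gen_euler_poly d \<chi> (m - 1) (n - k) (of_nat w1 * y)
        * (\<Sum>i<w1 * d. \<chi> (int i) * (-1) ^ i
             * gen_euler_poly d \<chi> m k (of_nat w2 * x + of_nat w2 / of_nat w1 * of_nat i)))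
   = fact n * (fps_const (1 / 2) * (G w1 * G w2) ^ m * fps_exp (of_nat (w1 * w2) * (x + y))
       * (fps_exp (of_nat (w1 * w2 * d)) + 1)) $ n"
    (is "?lhs = _")
proof -
  \<comment> \<open>\<open>?A\<close> generates the inner sums weighted by \<open>w1 ^ k\<close>,
    and \<open>?B\<close> the polynomials of order \<open>m - 1\<close> weighted by powers of
    \<open>w2\<close>.\<close>
  let ?S = "fps_scale (of_nat w2) (char_exp_sum \<chi> (w1 * d))"
  let ?A = "G w1 ^ m * fps_exp (of_nat (w1 * w2) * x) * ?S"
  let ?B = "G w2 ^ (m - 1) * fps_exp (of_nat (w1 * w2) * y)"
  have w1: "(of_nat w1 :: complex) \<noteq> 0"
    using assms(3) by (auto elim: oddE)
  have S: "?S = (\<Sum>i<w1 * d. fps_const ((-1) ^ i * \<chi> (int i)) * fps_exp (of_nat w2 * of_nat i))"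
    by (simp add: char_exp_sum_def fps_compose_sum_distrib fps_compose_mult_distrib
        fps_exp_compose_linear)
  have inner: "of_nat w1 ^ k * (\<Sum>i<w1 * d. \<chi> (int i) * (-1) ^ i
             * gen_euler_poly d \<chi> m k (of_nat w2 * x + of_nat w2 / of_nat w1 * of_nat i))
        = fact k * ?A $ k" for k
  proof -
    have "of_nat w1 ^ k * (\<chi> (int i) * (-1) ^ i
             * gen_euler_poly d \<chi> m k (of_nat w2 * x + of_nat w2 / of_nat w1 * of_nat i))
        = fact k * (G w1 ^ m * fps_exp (of_nat (w1 * w2) * x)
             * (fps_const ((-1) ^ i * \<chi> (int i)) * fps_exp (of_nat w2 * of_nat i))) $ k" for i
    proof -
      \<comment> \<open>Scaling by \<open>w1\<close> clears the denominator of the shift, which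
        leaves a factor exp(w2 i t); summed over \<open>i\<close>, these factors make up
        \<open>?S\<close>.\<close>
      have "of_nat w1 * (of_nat w2 * x + of_nat w2 / of_nat w1 * of_nat i)
          = of_nat (w1 * w2) * x + of_nat w2 * of_nat i"
        using w1 by (simp add: field_simps)
      then have "of_nat w1 ^ k
             * gen_euler_poly d \<chi> m k (of_nat w2 * x + of_nat w2 / of_nat w1 * of_nat i)
          = fact k * (G w1 ^ m * (fps_exp (of_nat (w1 * w2) * x) * fps_exp (of_nat w2 * of_nat i))) $ k"
        unfolding power_mult_gen_euler_poly G_def by (simp only: fps_exp_add_mult)
      moreover have "(G w1 ^ m * fps_exp (of_nat (w1 * w2) * x)
             * (fps_const ((-1) ^ i * \<chi> (int i)) * fps_exp (of_nat w2 * of_nat i))) $ k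
          = (-1) ^ i * \<chi> (int i)
             * (G w1 ^ m * (fps_exp (of_nat (w1 * w2) * x) * fps_exp (of_nat w2 * of_nat i))) $ k"
        by (subst fps_mult_left_const_nth[symmetric]) (simp only: mult_ac)
      ultimately show ?thesis
        by (simp only: mult_ac)
    qed
    then show ?thesis
      unfolding S by (simp only: sum_distrib_left fps_sum_nth)
  qed
  have outer: "of_nat w2 ^ (n - k) * gen_euler_poly d \<chi> (m - 1) (n - k) (of_nat w1 * y)
        = fact (n - k) * ?B $ (n - k)" for k
    unfolding power_mult_gen_euler_poly G_def by (simp add: mult_ac)
  have "?lhs = (\<Sum>k=0..n. of_nat (n choose k) * (fact k * ?A $ k) * (fact (n - k) * ?B $ (n - k)))"
    unfolding inner[symmetric] outer[symmetric] by (simp only: mult_ac)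
  also have "\<dots> = fact n * (?A * ?B) $ n"
    by (rule binomial_sum_fps_nth)
  also have "?A * ?B = fps_const (1 / 2) * (G w1 * G w2) ^ m
       * fps_exp (of_nat (w1 * w2) * (x + y)) * (fps_exp (of_nat (w1 * w2 * d)) + 1)"
  proof -
    have half: "f = fps_const (1 / 2) * (2 * f)" for f :: "complex fps"
      by (simp add: fps_eq_iff fps_numeral_fps_const)
    have "fps_scale (of_nat w2) (2 * char_exp_sum \<chi> (w1 * d))
        = fps_scale (of_nat w2) (euler_quotient d \<chi> * (fps_exp (of_nat (w1 * d)) + 1))"
      using char_exp_sum_eq_euler_quotient[OF assms(1-3)] by simp
    moreover have "of_nat (w1 * w2 * d) = (of_nat w2 * of_nat (w1 * d) :: complex)"
      by simp
    ultimately have "2 * ?S = G w2 * (fps_exp (of_nat (w1 * w2 * d)) + 1)"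
      by (simp add: G_def fps_compose_mult_distrib fps_compose_add_distrib fps_exp_compose_linear
          fps_numeral_fps_const del: of_nat_mult)
    then have S2: "?S = fps_const (1 / 2) * (G w2 * (fps_exp (of_nat (w1 * w2 * d)) + 1))"
      using half[of ?S] by simp
    \<comment> \<open>Since \<open>m \<ge> 1\<close>, the factor \<open>G w2\<close> coming from
      \<open>?S\<close> raises the power \<open>m - 1\<close> in \<open>?B\<close> to
      \<open>m\<close>.\<close>
    have "G w2 ^ m = G w2 * G w2 ^ (m - 1)"
      using assms(4) by (simp flip: power_Suc)
    then show ?thesis
      unfolding S2 distrib_left[of _ x y] fps_exp_add_mult power_mult_distrib
      by (simp only: mult_ac)
  qed
  finally show ?thesis .
qed

theorem theorem3:
  fixes d w1 w2 n m :: nat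
    and \<chi> :: "int \<Rightarrow> complex"
    and x y :: complex
  assumes "odd d"
    and "dirichlet_char d \<chi>"
    and "dirichlet_conductor d \<chi> = d"
    and "odd w1"
    and "odd w2"
    and "m \<ge> 1"
  shows
    "(\<Sum>k=0..n. of_nat (n choose k) * of_nat w1 ^ k * of_nat w2 ^ (n - k)
        * gen_euler_poly d \<chi> (m - 1) (n - k) (of_nat w1 * y)
        * (\<Sum>i<w1 * d. \<chi> (int i) * (-1) ^ i
             * gen_euler_poly d \<chi> m k (of_nat w2 * x + of_nat w2 / of_nat w1 * of_nat i)))
   = (\<Sum>k=0..n. of_nat (n choose k) * of_nat w2 ^ k * of_nat w1 ^ (n - k)
        * gen_euler_poly d \<chi> (m - 1) (n - k) (of_nat w2 * y)
        * (\<Sum>i<w2 * d. \<chi> (int i) * (-1) ^ i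
             * gen_euler_poly d \<chi> m k (of_nat w1 * x + of_nat w1 / of_nat w2 * of_nat i)))"
  \<comment> \<open>The two instances exchange \<open>w1\<close> and \<open>w2\<close>; their
    right-hand sides agree by commutativity of multiplication.\<close>
  using sum_gen_euler_poly_eq_fps_nth[OF assms(2,1,4,6), of n w2 y x]
    sum_gen_euler_poly_eq_fps_nth[OF assms(2,1,5,6), of n w1 y x]
  by (simp only: mult_ac)

end
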